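(* Let $\mathrm{Par}(\mathbf{2})$ be the set of all partial functions of all positive arities on $\mathbf{2}=\{0,1\}$, let $\mathrm{pPol}(\le)$ be the partial clone of all monotone partial functions on $\mathbf{2}$, and let $\mathrm{pPol}(\ne)$ be the partial clone of all self-dual partial functions on $\mathbf{2}$. Then the interval of partial clones $[\mathrm{pPol}(\le)\cap \mathrm{pPol}(\ne),\ \mathrm{Par}(\mathbf{2})]$, i.e. the set of all partial clones $C$ on $\mathbf{2}$ with $\mathrm{pPol}(\le)\cap \mathrm{pPol}(\ne)\subseteq C\subseteq \mathrm{Par}(\mathbf{2})$, has the cardinality of the continuum.
   Context: Let $\mathbf{2}=\{0,1\}$. For $n\ge 1$, an $n$-ary partial function on $\mathbf{2}$ is a map $f:\mathrm{dom}(f)\to\mathbf{2}$ with $\mathrm{dom}(f)\subseteq \mathbf{2}^n$ (possibly empty). $\mathrm{Par}^{(n)}(\mathbf{2})$ is the set of all $n$-ary partial functions and $\mathrm{Par}(\mathbf{2})=\bigcup_{n\ge1}\mathrm{Par}^{(n)}(\mathbf{2})$. For $n,m\ge 1$, $f\in \mathrm{Par}^{(n)}(\mathbf{2})$ and $g_1,\dots,g_n\in \mathrm{Par}^{(m)}(\mathbf{2})$, the composition $f[g_1,\dots,g_n]\in \mathrm{Par}^{(m)}(\mathbf{2})$ has domain $\{\vec a\in\mathbf{2}^m : \vec a\in\bigcap_{i=1}^n \mathrm{dom}(g_i),\ (g_1(\vec a),\dots,g_n(\vec a))\in\mathrm{dom}(f)\}$ and is given there by $f[g_1,\dots,g_n](\vec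 a)=f(g_1(\vec a),\dots,g_n(\vec a))$. The (total) projections are $e^n_i(a_1,\dots,a_n)=a_i$ for all $(a_1,\dots,a_n)\in\mathbf{2}^n$, $1\le i\le n$. A partial clone on $\mathbf{2}$ is a subset of $\mathrm{Par}(\mathbf{2})$ that contains all projections and is closed under composition. For an $h$-ary relation $\rho\subseteq\mathbf{2}^h$, an $n$-ary partial function $f$ preserves $\rho$ if for every $h\times n$ matrix $M$ over $\mathbf{2}$ whose columns all belong to $\rho$ and whose rows $M_{1*},\dots,M_{h*}$ all belong to $\mathrm{dom}(f)$, we have $(f(M_{1*}),\dots,f(M_{h*}))\in\rho$. $\mathrm{pPol}\,\rho$ is the set of all $f\in\mathrm{Par}(\mathbf{2})$ preserving $\rho$; it is a partial clone. Put $\mathrm{pPol}(\le)=\mathrm{pPol}\{(0,0),(0,1),(1,1)\}$ and $\mathrm{pPol}(\ne)=\mathrm{pPol}\{(0,1),(1,0)\}$. Equivalently, $f\in\mathrm{pPol}(\le)$ iff $f(\mathbf a)\le f(\mathbf b)$ whenever $\mathbf a,\mathbf b\in\mathrm{dom}(f)$ and $\mathbf a\le\mathbf b$ coordinatewise; $f\in\mathrm{pPol}(\ne)$ iff $f(\mathbf a+1)=f(\mathbf a)+1$ whenever $\mathbf a,\mathbf a+1\in\mathrm{dom}(f)$, where $\mathbf a+1$ adds $1$ to every coordinate and sums are mod 2. *)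

theory Defs
  imports Complex_Main "HOL-Library.Equipollence"
begin

text \<open>
  The set \<open>{0, 1}\<close> is represented by \<^typ>\<open>bool\<close> (\<open>0\<close> is \<^term>\<open>False\<close>), and tuples by lists.  The arity is
  stored explicitly because the nowhere defined functions of different arities have to be
  distinguished.
\<close>

type_synonym pfun = "nat \<times> (bool list \<Rightarrow> bool option)"

definition Par_n :: "nat \<Rightarrow> pfun set" where
  "Par_n n = {(n, f) | f. dom f \<subseteq> {a. length a = n}}"

definition Par :: "pfun set" where
  "Par = (\<Union>n\<in>{1..}. Par_n n)"

text \<open>
  \<open>pcomp m f [g\<^sub>1, \<dots>, g\<^sub>n]\<close> is the composition \<open>f[g\<^sub>1, \<dots>, g\<^sub>n]\<close>, where \<open>m\<close> is the common arity of the \<open>g\<^sub>i\<close>.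
\<close>

definition pcomp :: "nat \<Rightarrow> pfun \<Rightarrow> pfun list \<Rightarrow> pfun" where
  "pcomp m f gs =
     (m, \<lambda>a. if length a = m \<and> (\<forall>g\<in>set gs. a \<in> dom (snd g))
             then snd f (map (\<lambda>g. the (snd g a)) gs) else None)"

text \<open>Coordinates are numbered from \<open>0\<close>, so \<open>proj n i\<close> with \<open>i < n\<close> is \<open>e\<^sup>n\<^bsub>i+1\<^esub>\<close>.\<close>

definition proj :: "nat \<Rightarrow> nat \<Rightarrow> pfun" where
  "proj n i = (n, \<lambda>a. if length a = n then Some (a ! i) else None)"

definition partial_clone :: "pfun set \<Rightarrow> bool" where
  "partial_clone C \<longleftrightarrow>
     C \<subseteq> Par \<and>
     (\<forall>n\<ge>1. \<forall>i<n. proj n i \<in> C) \<and>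
     (\<forall>n\<ge>1. \<forall>m\<ge>1. \<forall>f \<in> C \<inter> Par_n n. \<forall>gs.
        length gs = n \<and> set gs \<subseteq> C \<inter> Par_n m \<longrightarrow> pcomp m f gs \<in> C)"

text \<open>
  An \<open>h \<times> n\<close> matrix is the list \<open>M\<close> of its \<open>h\<close> rows; its \<open>j\<close>-th column is \<^term>\<open>map (\<lambda>r. r ! j) M\<close>.
\<close>

definition preserves :: "nat \<Rightarrow> bool list set \<Rightarrow> pfun \<Rightarrow> bool" where
  "preserves h \<rho> f \<longleftrightarrow>
     (\<forall>M. length M = h \<and> (\<forall>r\<in>set M. length r = fst f) \<and>
          (\<forall>j<fst f. map (\<lambda>r. r ! j) M \<in> \<rho>) \<and>
          (\<forall>r\<in>set M. r \<in> dom (snd f)) \<longrightarrow>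
          map (\<lambda>r. the (snd f r)) M \<in> \<rho>)"

definition pPol :: "nat \<Rightarrow> bool list set \<Rightarrow> pfun set" where
  "pPol h \<rho> = {f \<in> Par. preserves h \<rho> f}"

definition rel_le :: "bool list set" where
  "rel_le = {[False, False], [False, True], [True, True]}"

definition rel_ne :: "bool list set" where
  "rel_ne = {[False, True], [True, False]}"

abbreviation pPol_le :: "pfun set" where
  "pPol_le \<equiv> pPol 2 rel_le"

abbreviation pPol_ne :: "pfun set" where
  "pPol_ne \<equiv> pPol 2 rel_ne"

definition clone_interval :: "pfun set \<Rightarrow> pfun set \<Rightarrow> pfun set set" where
  "clone_interval A B = {C. partial_clone C \<and> A \<subseteq> C \<and> C \<subseteq> B}"

lemma Par_n_subset_Par: "n \<ge> 1 \<Longrightarrow> Par_n n \<subseteq> Par"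
  by (auto simp: Par_def)

lemma Par_iff: "f \<in> Par \<longleftrightarrow> fst f \<ge> 1 \<and> dom (snd f) \<subseteq> {a. length a = fst f}"
  by (cases f) (auto simp: Par_def Par_n_def)

lemma Par_n_iff: "f \<in> Par_n n \<longleftrightarrow> fst f = n \<and> dom (snd f) \<subseteq> {a. length a = n}"
  by (cases f) (auto simp: Par_n_def)

lemma proj_in_Par_n: "proj n i \<in> Par_n n"
  by (auto simp: Par_n_iff proj_def split: if_splits)

lemma pcomp_in_Par_n: "pcomp m f gs \<in> Par_n m"
  by (auto simp: Par_n_iff pcomp_def split: if_splits)

lemma partial_clone_Par: "partial_clone Par"
  unfolding partial_clone_def
proof (intro conjI allI impI ballI)
  show "proj n i \<in> Par" if "1 \<le> n" for n i
    using proj_in_Par_n Par_n_subset_Par[OF that] by (rule subsetD[rotated])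
  show "pcomp m f gs \<in> Par" if "1 \<le> m" for m f gs
    using pcomp_in_Par_n Par_n_subset_Par[OF that] by (rule subsetD[rotated])
qed simp

lemma preserves_2_iff:
  assumes "f \<in> Par"
  shows "preserves 2 \<rho> f \<longleftrightarrow>
     (\<forall>a\<in>dom (snd f). \<forall>b\<in>dom (snd f).
       (\<forall>j<fst f. [a ! j, b ! j] \<in> \<rho>) \<longrightarrow> [the (snd f a), the (snd f b)] \<in> \<rho>)"
    (is "?L \<longleftrightarrow> ?R")
proof
  assume L: ?L
  show ?R
  proof (intro ballI impI)
    fix a b assume ab: "a \<in> dom (snd f)" "b \<in> dom (snd f)" "\<forall>j<fst f. [a ! j, b ! j] \<in> \<rho>"
    have "length a = fst f" "length b = fst f"
      using assms ab(1,2) by (auto simp: Par_iff)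
    then show "[the (snd f a), the (snd f b)] \<in> \<rho>"
      using L[unfolded preserves_def, rule_format, of "[a, b]"] ab by simp
  qed
next
  assume R: ?R
  show ?L
    unfolding preserves_def
  proof (intro allI impI, elim conjE)
    fix M :: "bool list list"
    assume M: "length M = 2" "\<forall>j<fst f. map (\<lambda>r. r ! j) M \<in> \<rho>" "\<forall>r\<in>set M. r \<in> dom (snd f)"
    from M(1) obtain a b where ab: "M = [a, b]"
      by (auto simp: numeral_2_eq_2 length_Suc_conv)
    have "a \<in> dom (snd f)" "b \<in> dom (snd f)" "\<forall>j<fst f. [a ! j, b ! j] \<in> \<rho>"
      using M(2,3) ab by simp_all
    with R have "[the (snd f a), the (snd f b)] \<in> \<rho>"
      by blast
    then show "map (\<lambda>r. the (snd f r)) M \<in> \<rho>"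
      by (simp add: ab)
  qed
qed

lemma pPol_le_iff_monotone:
  "f \<in> pPol_le \<longleftrightarrow>
     f \<in> Par \<and> (\<forall>a\<in>dom (snd f). \<forall>b\<in>dom (snd f).
       list_all2 (\<le>) a b \<longrightarrow> the (snd f a) \<le> the (snd f b))"
proof (cases "f \<in> Par")
  case True
  have 1: "[x, y] \<in> rel_le \<longleftrightarrow> x \<le> y" for x y
    unfolding rel_le_def by (cases x; cases y) simp_all
  have 2: "length a = fst f" if "a \<in> dom (snd f)" for a
    using True that by (auto simp: Par_iff)
  have 3: "(\<forall>j<fst f. [a ! j, b ! j] \<in> rel_le) \<longleftrightarrow> list_all2 (\<le>) a b"
    if "a \<in> dom (snd f)" "b \<in> dom (snd f)" for a b
    using 2[OF that(1)] 2[OF that(2)] unfolding list_all2_conv_all_nth 1 by simp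
  have "preserves 2 rel_le f \<longleftrightarrow> (\<forall>a\<in>dom (snd f). \<forall>b\<in>dom (snd f).
       list_all2 (\<le>) a b \<longrightarrow> the (snd f a) \<le> the (snd f b))"
    unfolding preserves_2_iff[OF True] using 3 1 by blast
  with True show ?thesis by (simp add: pPol_def)
qed (simp add: pPol_def)

lemma pPol_ne_iff_self_dual:
  "f \<in> pPol_ne \<longleftrightarrow>
     f \<in> Par \<and> (\<forall>a\<in>dom (snd f). map Not a \<in> dom (snd f) \<longrightarrow>
       the (snd f (map Not a)) = (\<not> the (snd f a)))"
proof (cases "f \<in> Par")
  case True
  have 1: "[x, y] \<in> rel_ne \<longleftrightarrow> y = (\<not> x)" for x y
    unfolding rel_ne_def by (cases x; cases y) simp_all
  have 2: "length a = fst f" if "a \<in> dom (snd f)" for a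
    using True that by (auto simp: Par_iff)
  have 3: "(\<forall>j<fst f. [a ! j, b ! j] \<in> rel_ne) \<longleftrightarrow> b = map Not a"
    if "a \<in> dom (snd f)" "b \<in> dom (snd f)" for a b
    using 2[OF that(1)] 2[OF that(2)] unfolding list_eq_iff_nth_eq 1 by simp
  have "preserves 2 rel_ne f \<longleftrightarrow> (\<forall>a\<in>dom (snd f). \<forall>b\<in>dom (snd f).
       b = map Not a \<longrightarrow> the (snd f b) = (\<not> the (snd f a)))"
    unfolding preserves_2_iff[OF True] by (intro ball_cong refl, simp only: 3, simp only: 1)
  also have "\<dots> \<longleftrightarrow> (\<forall>a\<in>dom (snd f). map Not a \<in> dom (snd f) \<longrightarrow> 
       the (snd f (map Not a)) = (\<not> the (snd f a)))"
    by (intro ball_cong refl) blast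
  finally show ?thesis
    using True unfolding pPol_def by (simp only: mem_Collect_eq simp_thms)
qed (simp add: pPol_def)

end

theory Submission
  imports Defs "HOL-Analysis.Abstract_Topology_2"
begin

text \<open>
  For a graph \<open>G\<close>, the pairs \<open>(x, \<not>x)\<close> with \<open>x\<close> the characteristic vector of an independent set of \<open>G\<close>
  form a relation preserved by all monotone self-dual partial functions: an edge \<open>uv\<close>
  expresses \<open>x\<^sub>u \<le> \<not>x\<^sub>v\<close>.  Given an edge \<open>e\<close> of \<open>G\<close>, there is a partial function that violates this
  relation only at \<open>e\<close>; it preserves the relation of a graph \<open>H\<close> unless some
  homomorphism from \<open>H\<close> to \<open>G\<close> with a pendant edge attached to every vertex has \<open>e\<close> in its image.
  Let \<open>G\<^sub>k\<close> be the complete graph on \<open>k \<ge> 3\<close> vertices with a path of length \<open>k\<close>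
  attached, and let \<open>e\<close> be the last edge of the path.  For \<open>j > k\<close> there is no homomorphism from \<open>G\<^sub>j\<close>,
  since its clique is too large; for \<open>j < k\<close> the clique of \<open>G\<^sub>j\<close> goes to
  the clique of \<open>G\<^sub>k\<close> and the path of \<open>G\<^sub>j\<close> is too short to reach \<open>e\<close>.  So the relations of the
  graphs \<open>G\<^sub>k\<close> are independent, and every subset of them determines a different partial clone.
\<close>

section \<open>Partial clones of relations\<close>

lemma preserves_proj:
  assumes "i < n"
  shows "preserves h \<rho> (proj n i)"
  unfolding preserves_def
proof (intro allI impI, elim conjE)
  fix M
  assume M: "\<forall>r\<in>set M. length r = fst (proj n i)"
    "\<forall>j<fst (proj n i). map (\<lambda>r. r ! j) M \<in> \<rho>"
  have "map (\<lambda>r. the (snd (proj n i) r)) M = map (\<lambda>r. r ! i) M"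
    using M(1) by (simp add: proj_def)
  moreover have "map (\<lambda>r. r ! i) M \<in> \<rho>"
    using M(2) assms by (simp add: proj_def)
  ultimately show "map (\<lambda>r. the (snd (proj n i) r)) M \<in> \<rho>"
    by (simp only:)
qed

lemma preserves_pcomp:
  assumes f: "f \<in> Par_n (length gs)" "preserves h \<rho> f"
    and gs: "\<And>g. g \<in> set gs \<Longrightarrow> g \<in> Par_n m \<and> preserves h \<rho> g"
  shows "preserves h \<rho> (pcomp m f gs)"
  unfolding preserves_def
proof (intro allI impI, elim conjE)
  fix M
  let ?c = "pcomp m f gs"
  assume M: "length M = h" "\<forall>r\<in>set M. length r = fst ?c"
    "\<forall>j<fst ?c. map (\<lambda>r. r ! j) M \<in> \<rho>" "\<forall>r\<in>set M. r \<in> dom (snd ?c)"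
  define ev where "ev r = map (\<lambda>g. the (snd g r)) gs" for r
  have fst_c: "fst ?c = m"
    by (simp add: pcomp_def)
  have dom: "r \<in> dom (snd g)" if "r \<in> set M" "g \<in> set gs" for r g
    using M(4) that by (fastforce simp: pcomp_def dom_def split: if_splits)
  have c: "snd ?c r = snd f (ev r)" if "r \<in> set M" for r
    using that dom M(2) by (auto simp: pcomp_def ev_def)
  have cols: "map (\<lambda>r. r ! j) (map ev M) \<in> \<rho>" if j: "j < length gs" for j
  proof -
    have g: "gs ! j \<in> Par_n m" "preserves h \<rho> (gs ! j)"
      using gs j by auto
    have "map (\<lambda>r. the (snd (gs ! j) r)) M \<in> \<rho>"
      by (rule g(2)[unfolded preserves_def, rule_format])
        (use M g(1) fst_c dom j in \<open>auto simp: Par_n_iff\<close>)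
    then show ?thesis
      using j by (simp add: ev_def comp_def)
  qed
  have "map (\<lambda>r. the (snd f r)) (map ev M) \<in> \<rho>"
  proof (rule f(2)[unfolded preserves_def, rule_format], intro conjI)
    show "\<forall>r\<in>set (map ev M). length r = fst f"
      using f(1) by (auto simp: Par_n_iff ev_def)
    show "\<forall>j<fst f. map (\<lambda>r. r ! j) (map ev M) \<in> \<rho>"
      using f(1) cols by (auto simp: Par_n_iff)
    show "\<forall>r\<in>set (map ev M). r \<in> dom (snd f)"
      using M(4) c by (auto simp: dom_def)
  qed (simp add: M(1))
  moreover have "map (\<lambda>r. the (snd f r)) (map ev M) = map (\<lambda>r. the (snd ?c r)) M"
    using c by simp
  ultimately show "map (\<lambda>r. the (snd ?c r)) M \<in> \<rho>"
    by (simp only:)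
qed

lemma partial_clone_preserves:
  "partial_clone {f \<in> Par. \<forall>k\<in>X. preserves (h k) (\<rho> k) f}"
  unfolding partial_clone_def
proof (intro conjI allI impI ballI)
  fix n m :: nat and f gs
  assume "1 \<le> m" "f \<in> {f \<in> Par. \<forall>k\<in>X. preserves (h k) (\<rho> k) f} \<inter> Par_n n"
    "length gs = n \<and> set gs \<subseteq> {f \<in> Par. \<forall>k\<in>X. preserves (h k) (\<rho> k) f} \<inter> Par_n m"
  then show "pcomp m f gs \<in> {f \<in> Par. \<forall>k\<in>X. preserves (h k) (\<rho> k) f}"
    using pcomp_in_Par_n[of m f gs] Par_n_subset_Par[of m]
    by (auto intro!: preserves_pcomp)
next
  fix n i :: nat
  assume "1 \<le> n" "i < n"
  then show "proj n i \<in> {f \<in> Par. \<forall>k\<in>X. preserves (h k) (\<rho> k) f}"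
    using proj_in_Par_n Par_n_subset_Par by (blast intro: preserves_proj)
qed auto

text \<open>The arity and the finite table of values determine a partial function. This gives the
  upper bound, as partial clones are subsets of \<open>Par\<close>.\<close>

lemma countable_Par: "countable Par"
proof (rule countableI')
  let ?enc = "\<lambda>f :: pfun. (fst f, map (snd f) (List.n_lists (fst f) [True, False]))"
  have "f = g" if "f \<in> Par" "g \<in> Par" "?enc f = ?enc g" for f g
  proof (rule prod_eqI)
    show 1: "fst f = fst g"
      using that by simp
    have "snd f a = snd g a" for a
    proof (cases "length a = fst f")
      case True
      then have "a \<in> set (List.n_lists (fst f) [True, False])"
        by (auto simp: set_n_lists)
      moreover have "map (snd f) (List.n_lists (fst f) [True, False]) =
          map (snd g) (List.n_lists (fst f) [True, False])"
        using that(3) 1 by simp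
      ultimately show ?thesis
        unfolding map_eq_conv by (rule bspec[rotated])
    next
      case False
      then have "a \<notin> dom (snd f)" "a \<notin> dom (snd g)"
        using that(1,2) 1 by (auto simp: Par_iff)
      then show ?thesis
        by (simp add: domIff)
    qed
    then show "snd f = snd g" ..
  qed
  then have "inj_on ?enc Par"
    by (rule inj_onI)
  then show "inj_on (to_nat \<circ> ?enc) Par"
    by (intro comp_inj_on) (auto intro: inj_on_subset[OF inj_to_nat])
qed

section \<open>Independence relations of graphs\<close>

definition indep_rel :: "nat \<Rightarrow> (nat \<Rightarrow> nat \<Rightarrow> bool) \<Rightarrow> bool list set" where
  "indep_rel n E = {x. length x = 2 * n \<and> (\<forall>i<n. x ! (n + i) = (\<not> x ! i)) \<and>
     (\<forall>i<n. \<forall>j<n. E i j \<longrightarrow> \<not> (x ! i \<and> x ! j))}"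

lemma preserves_indep_rel:
  assumes f: "f \<in> pPol_le" "f \<in> pPol_ne"
  shows "preserves (2 * n) (indep_rel n E) f"
  unfolding preserves_def
proof (intro allI impI, elim conjE)
  fix M
  assume M: "length M = 2 * n" "\<forall>r\<in>set M. length r = fst f"
    "\<forall>j<fst f. map (\<lambda>r. r ! j) M \<in> indep_rel n E" "\<forall>r\<in>set M. r \<in> dom (snd f)"
  have row: "length (M ! i) = fst f" "M ! i \<in> dom (snd f)" if "i < 2 * n" for i
    using M that by auto
  have dual: "M ! (n + i) = map Not (M ! i)" if "i < n" for i
  proof (rule nth_equalityI)
    fix j assume "j < length (M ! (n + i))"
    then show "M ! (n + i) ! j = map Not (M ! i) ! j"
      using that M(1,3) row[of "n + i"] row[of i] by (auto simp: indep_rel_def)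
  qed (use that row[of i] row[of "n + i"] in simp)
  have neg: "the (snd f (M ! (n + i))) = (\<not> the (snd f (M ! i)))" if "i < n" for i
    using f(2) dual[OF that] row[of i] row[of "n + i"] that
    unfolding pPol_ne_iff_self_dual by auto
  have edge: "\<not> (the (snd f (M ! i)) \<and> the (snd f (M ! j)))" if "i < n" "j < n" "E i j" for i j
  proof -
    \<comment> \<open>No column is true in both rows \<open>i\<close> and \<open>j\<close>, and row
      \<open>n + j\<close> negates row \<open>j\<close>.\<close>
    have "list_all2 (\<le>) (M ! i) (M ! (n + j))"
      unfolding list_all2_conv_all_nth
      using that row[of i] row[of j] row[of "n + j"] M(1,3) dual
      by (auto simp: indep_rel_def)
    then have "the (snd f (M ! i)) \<le> the (snd f (M ! (n + j)))"
      using f(1) that row[of i] row[of "n + j"] unfolding pPol_le_iff_monotone by auto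
    then show ?thesis
      using neg that by auto
  qed
  show "map (\<lambda>r. the (snd f r)) M \<in> indep_rel n E"
    using neg edge M(1) by (simp add: indep_rel_def)
qed

text \<open>
  A homomorphism from a graph on \<open>{..<m}\<close> to a graph on \<open>{..<n}\<close> with a pendant edge attached to
  every vertex: \<open>i\<close> goes to the vertex \<open>h i\<close> if \<open>s i\<close>, and to its pendant neighbour otherwise.
\<close>

definition pendant_hom ::
    "nat \<Rightarrow> (nat \<Rightarrow> nat \<Rightarrow> bool) \<Rightarrow> nat \<Rightarrow> (nat \<Rightarrow> nat \<Rightarrow> bool) \<Rightarrow> (nat \<Rightarrow> nat) \<Rightarrow> (nat \<Rightarrow> bool) \<Rightarrow> bool" where
  "pendant_hom m F n E h s \<longleftrightarrow>
     (\<forall>i<m. h i < n) \<and>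
     (\<forall>i<m. \<forall>j<m. F i j \<longrightarrow> s i \<and> s j \<and> E (h i) (h j) \<or> s i \<noteq> s j \<and> h i = h j)"

text \<open>
  The arguments of the separating function are the rows of the matrix whose columns are all
  elements of the relation; its values violate only the edge \<open>ab\<close>.
\<close>

lemma separating_function:
  assumes E: "symp E" "irreflp E" and ab: "a < n" "b < n" "E a b"
  obtains f where "f \<in> Par" "\<not> preserves (2 * n) (indep_rel n E) f"
    "\<And>m F. \<not> preserves (2 * m) (indep_rel m F) f \<Longrightarrow>
       \<exists>h s. pendant_hom m F n E h s \<and> (\<exists>i<m. h i = b)"
proof -
  have "finite {c. c \<subseteq> {..<n} \<and> (\<forall>i\<in>c. \<forall>j\<in>c. \<not> E i j)}"
    by (rule finite_subset[of _ "Pow {..<n}"]) auto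
  from finite_list[OF this] obtain cs
    where cs: "set cs = {c. c \<subseteq> {..<n} \<and> (\<forall>i\<in>c. \<forall>j\<in>c. \<not> E i j)}"
    by (elim exE)
  have empty: "{} \<in> set cs" and single: "u < n \<Longrightarrow> {u} \<in> set cs" for u
    using E(2) by (auto simp: cs irreflp_def)
  have pair: "{u, v} \<in> set cs" if "u < n" "v < n" "\<not> E u v" for u v
    using E that by (auto simp: cs irreflp_def symp_def)
  \<comment> \<open>Rows of the matrix whose columns are the independent sets: row \<open>u\<close>
    itself if \<open>s\<close>, its negation otherwise. The negation plays the pendant neighbour of
    \<open>u\<close>.\<close>
  define lit where "lit u s = map (\<lambda>c. (u \<in> c) = s) cs" for u s
  have length_lit: "length (lit u s) = length cs" for u s
    by (simp add: lit_def)
  have Not_lit: "map Not (lit u s) = lit u (\<not> s)" for u s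
    by (auto simp: lit_def)
  have lit_inj: "u = v \<and> s = t" if "u < n" "lit u s = lit v t" for u v s t
  proof -
    have "\<forall>c\<in>set cs. ((u \<in> c) = s) = ((v \<in> c) = t)"
      using that(2) by (simp add: lit_def)
    from bspec[OF this empty] bspec[OF this single[OF that(1)]] show ?thesis
      by auto
  qed
  \<comment> \<open>Literals that no independent set makes true together are adjacent in the graph
    with pendant edges. The empty set, singletons and non-adjacent pairs suffice as
    witnesses.\<close>
  have lit_disjoint: "s \<and> t \<and> E u v \<or> s \<noteq> t \<and> u = v"
    if "u < n" "v < n" "\<forall>c\<in>set cs. \<not> ((u \<in> c) = s \<and> (v \<in> c) = t)" for u v s t
    using bspec[OF that(3) empty] bspec[OF that(3) single[OF that(1)]]
      bspec[OF that(3) single[OF that(2)]] bspec[OF that(3) pair[OF that(1,2)]]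
    by auto
  \<comment> \<open>On the rows of the vertices, \<open>f\<close> will take the values of the
    characteristic vector of {a, b}; \<open>lit_inj\<close> ensures that no row gets two
    values.\<close>
  define T where "T = {lit u (u = a \<or> u = b) |u. u < n}"
  define f :: pfun where
    "f = (length cs, \<lambda>r. if r \<in> T then Some True else if map Not r \<in> T then Some False else None)"
  have in_T: "lit u s \<in> T \<longleftrightarrow> s = (u = a \<or> u = b)" if "u < n" for u s
  proof
    assume "lit u s \<in> T"
    then obtain v where "lit u s = lit v (v = a \<or> v = b)"
      unfolding T_def by blast
    from lit_inj[OF that this] show "s = (u = a \<or> u = b)"
      by simp
  qed (use that in \<open>unfold T_def, blast\<close>)
  have f_lit: "snd f (lit u s) = Some (s = (u = a \<or> u = b))" if "u < n" for u s
    using in_T[OF that] by (auto simp: f_def Not_lit)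
  have dom_f: "\<exists>u s. u < n \<and> r = lit u s" if "r \<in> dom (snd f)" for r
  proof -
    have "r \<in> T \<or> map Not r \<in> T"
      using that by (auto simp: f_def split: if_splits)
    then show ?thesis
    proof
      assume "map Not r \<in> T"
      then obtain u s where u: "u < n" "map Not r = lit u s"
        by (auto simp: T_def)
      have "r = map Not (map Not r)"
        by (simp add: comp_def)
      then show ?thesis
        using u Not_lit by metis
    qed (auto simp: T_def)
  qed
  show thesis
  proof
    show "f \<in> Par"
      unfolding Par_iff
    proof
      show "1 \<le> fst f"
        using empty by (cases cs) (auto simp: f_def)
      show "dom (snd f) \<subseteq> {r. length r = fst f}"
      proof
        fix r assume "r \<in> dom (snd f)"
        then obtain u s where "r = lit u s"
          using dom_f by blast
        then show "r \<in> {r. length r = fst f}"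
          by (simp add: length_lit f_def)
      qed
    qed
    show "\<not> preserves (2 * n) (indep_rel n E) f"
    proof
      let ?M = "map (\<lambda>u. lit u True) [0..<n] @ map (\<lambda>u. lit u False) [0..<n]"
      assume "preserves (2 * n) (indep_rel n E) f"
      from this[unfolded preserves_def, rule_format, of ?M]
      have "map (\<lambda>r. the (snd f r)) ?M \<in> indep_rel n E"
      proof (elim meta_mp, intro conjI)
        show "\<forall>j<fst f. map (\<lambda>r. r ! j) ?M \<in> indep_rel n E"
        proof (intro allI impI)
          fix j assume "j < fst f"
          then have j: "j < length cs"
            by (simp add: f_def)
          then have "cs ! j \<in> set cs"
            by simp
          with j show "map (\<lambda>r. r ! j) ?M \<in> indep_rel n E"
            by (auto simp: indep_rel_def nth_append lit_def cs)
        qed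
        show "\<forall>r\<in>set ?M. r \<in> dom (snd f)"
          by (auto simp: f_lit)
        show "\<forall>r\<in>set ?M. length r = fst f"
          by (auto simp: f_def length_lit)
      qed simp
      then have "\<not> (map (\<lambda>r. the (snd f r)) ?M ! a \<and> map (\<lambda>r. the (snd f r)) ?M ! b)"
        using ab unfolding indep_rel_def by blast
      then show False
        using ab by (simp add: nth_append f_lit)
    qed
    fix m F
    assume "\<not> preserves (2 * m) (indep_rel m F) f"
    then obtain M where M: "length M = 2 * m" "\<forall>j<length cs. map (\<lambda>r. r ! j) M \<in> indep_rel m F"
        "\<forall>r\<in>set M. r \<in> dom (snd f)" "map (\<lambda>r. the (snd f r)) M \<notin> indep_rel m F"
      unfolding preserves_def by (auto simp: f_def)
    \<comment> \<open>Rows in the domain are literals, so the matrix itself encodes the maps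
      \<open>h\<close> and \<open>s\<close>.\<close>
    have "\<forall>i<2 * m. \<exists>p. fst p < n \<and> M ! i = lit (fst p) (snd p)"
      using M(1,3) dom_f by (metis fst_conv nth_mem snd_conv)
    then obtain p where p: "\<And>i. i < 2 * m \<Longrightarrow> fst (p i) < n \<and> M ! i = lit (fst (p i)) (snd (p i))"
      by metis
    define h s where "h i = fst (p i)" and "s i = snd (p i)" for i
    have hs: "h i < n" "M ! i = lit (h i) (s i)" if "i < 2 * m" for i
      using p[OF that] by (simp_all add: h_def s_def)
    have dual: "M ! (m + i) = lit (h i) (\<not> s i)" if "i < m" for i
    proof -
      have "M ! (m + i) = map Not (M ! i)"
      proof (rule nth_equalityI)
        fix j assume "j < length (M ! (m + i))"
        then have "j < length cs" "j < length (M ! i)"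
          using that hs[of "m + i"] hs[of i] by (simp_all add: length_lit)
        moreover from this have "M ! (m + i) ! j = (\<not> M ! i ! j)"
          using that M(1,2) by (simp add: indep_rel_def)
        ultimately show "M ! (m + i) ! j = map Not (M ! i) ! j"
          by simp
      qed (use that hs[of "m + i"] hs[of i] in \<open>simp add: length_lit\<close>)
      then show ?thesis
        using that hs[of i] by (simp add: Not_lit)
    qed
    have edge: "s i \<and> s j \<and> E (h i) (h j) \<or> s i \<noteq> s j \<and> h i = h j"
      if "i < m" "j < m" "F i j" for i j
    proof (rule lit_disjoint)
      show "\<forall>c\<in>set cs. \<not> ((h i \<in> c) = s i \<and> (h j \<in> c) = s j)"
      proof
        fix c assume "c \<in> set cs"
        then obtain l where l: "l < length cs" "c = cs ! l"
          by (auto simp: in_set_conv_nth)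
        have "\<not> (M ! i ! l \<and> M ! j ! l)"
          using M(1,2) l(1) that by (auto simp: indep_rel_def)
        then show "\<not> ((h i \<in> c) = s i \<and> (h j \<in> c) = s j)"
          using hs[of i] hs[of j] that l by (simp add: lit_def)
      qed
    qed (use that hs in auto)
    have "pendant_hom m F n E h s"
      using hs edge by (auto simp: pendant_hom_def)
    moreover have "\<exists>i<m. h i = b"
    proof -
      \<comment> \<open>As \<open>f\<close> respects negation, the violation must occur at an edge
        of \<open>F\<close>, with both values true. A pendant edge would give opposite values, so
        the image is an edge inside {a, b}.\<close>
      have "\<forall>i<m. map (\<lambda>r. the (snd f r)) M ! (m + i) = (\<not> map (\<lambda>r. the (snd f r)) M ! i)"
        using M(1) hs dual by (auto simp: f_lit)
      with M(1,4) obtain i j where ij: "i < m" "j < m" "F i j"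
          "the (snd f (M ! i))" "the (snd f (M ! j))"
        by (auto simp: indep_rel_def)
      then have "s i = (h i = a \<or> h i = b)" "s j = (h j = a \<or> h j = b)"
        using hs[of i] hs[of j] by (auto simp: f_lit)
      then have "h i = b \<or> h j = b"
        using edge[OF ij(1-3)] E(2) by (auto simp: irreflp_def)
      then show ?thesis
        using ij by auto
    qed
    ultimately show "\<exists>h s. pendant_hom m F n E h s \<and> (\<exists>i<m. h i = b)"
      by blast
  qed
qed

section \<open>Cliques with a path attached\<close>

text \<open>The path is infinite here; restricting to vertices below \<open>2 * k\<close> leaves
  \<open>k\<close> path edges, from \<open>k - 1\<close> to \<open>2 * k - 1\<close>.\<close>

definition clique_path :: "nat \<Rightarrow> nat \<Rightarrow> nat \<Rightarrow> bool" where
  "clique_path k u v \<longleftrightarrow> u \<noteq> v \<and> (u < k \<and> v < k \<or> u = Suc v \<or> v = Suc u)"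

text \<open>A vertex \<open>u\<close> outside the clique has at most the neighbours
  \<open>u - 1\<close> and \<open>u + 1\<close>, which are not adjacent.\<close>

lemma clique_path_triangle:
  assumes "clique_path k u v" "clique_path k u w" "clique_path k v w"
  shows "u < k"
  using assms by (auto simp: clique_path_def)

lemma clique_path_hom_onto_end:
  assumes hom: "pendant_hom (2 * j) (clique_path j) (2 * k) (clique_path k) h s"
    and j: "3 \<le> j" and "i < 2 * j" "h i = 2 * k - 1"
  shows "j = k"
proof -
  have edge: "s i \<and> s i' \<and> clique_path k (h i) (h i') \<or> s i \<noteq> s i' \<and> h i = h i'"
    if "i < 2 * j" "i' < 2 * j" "clique_path j i i'" for i i'
    using hom that by (auto simp: pendant_hom_def)
  \<comment> \<open>As \<open>3 \<le> j\<close>, the edge lies in a triangle. If one of its edges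
    became pendant, another would become a loop, so the image is a triangle of
    \<open>clique_path k\<close>.\<close>
  have in_clique: "clique_path k (h u) (h v) \<and> h u < k" if "u < j" "v < j" "u \<noteq> v" for u v
  proof -
    have "card {u, v} < card {..<j}"
      using j that by simp
    then obtain w where w: "w < j" "w \<noteq> u" "w \<noteq> v"
      using card_mono[of "{u, v}" "{..<j}"] by force
    have "clique_path j u v" "clique_path j u w" "clique_path j v w" "u < 2 * j" "v < 2 * j" "w < 2 * j"
      using that w by (auto simp: clique_path_def)
    moreover have "\<not> clique_path k x x" for x
      by (simp add: clique_path_def)
    ultimately have "clique_path k (h u) (h v) \<and> clique_path k (h u) (h w) \<and> clique_path k (h v) (h w)"
      using edge[of u v] edge[of u w] edge[of v w] by metis
    then show ?thesis
      using clique_path_triangle by blast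
  qed
  have clique: "h u < k" if "u < j" for u
    using in_clique[of u "if u = 0 then 1 else 0"] that j by (auto split: if_splits)
  have "inj_on h {..<j}"
    using in_clique by (auto simp: inj_on_def clique_path_def)
  then have "j \<le> k"
    using clique card_inj_on_le[of h "{..<j}" "{..<k}"] by auto
  \<comment> \<open>Each path edge raises \<open>h\<close> by at most 1 beyond the clique, and
    pendant edges leave it unchanged.\<close>
  have path: "j - 1 + t < 2 * j \<Longrightarrow> h (j - 1 + t) \<le> k - 1 + t" for t
  proof (induction t)
    case 0
    then show ?case
      using clique[of "j - 1"] j by simp
  next
    case (Suc t)
    have "clique_path j (j - 1 + t) (j - 1 + Suc t)"
      by (simp add: clique_path_def)
    then have "clique_path k (h (j - 1 + t)) (h (j - 1 + Suc t)) \<or> h (j - 1 + t) = h (j - 1 + Suc t)"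
      using edge[of "j - 1 + t" "j - 1 + Suc t"] Suc.prems by auto
    then show ?case
      using Suc unfolding clique_path_def by (elim disjE conjE) linarith+
  qed
  have "\<not> i < j"
    using clique[of i] assms(4) by auto
  then have "h i \<le> k - 1 + (i - (j - 1))"
    using path[of "i - (j - 1)"] assms(3) j by simp
  \<comment> \<open>Here \<open>i - (j - 1) \<le> j\<close>, so
    \<open>2 * k - 1 \<le> k - 1 + j\<close>, that is, \<open>k \<le> j\<close>.\<close>
  then show "j = k"
    using assms(3,4) \<open>j \<le> k\<close> j by linarith
qed

lemma clique_path_separated:
  assumes "3 \<le> k"
  obtains f where "f \<in> Par"
    "\<And>j. 3 \<le> j \<Longrightarrow> preserves (2 * (2 * j)) (indep_rel (2 * j) (clique_path j)) f \<longleftrightarrow> j \<noteq> k"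
proof -
  have k: "symp (clique_path k)" "irreflp (clique_path k)" "2 * k - 2 < 2 * k" "2 * k - 1 < 2 * k"
      "clique_path k (2 * k - 2) (2 * k - 1)"
    using assms by (auto simp: symp_def irreflp_def clique_path_def)
  show thesis
  proof (rule separating_function[OF k])
    fix f
    assume f: "f \<in> Par"
      "\<not> preserves (2 * (2 * k)) (indep_rel (2 * k) (clique_path k)) f"
      "\<And>m F. \<not> preserves (2 * m) (indep_rel m F) f \<Longrightarrow>
         \<exists>h s. pendant_hom m F (2 * k) (clique_path k) h s \<and> (\<exists>i<m. h i = 2 * k - 1)"
    show thesis
    proof (rule that[OF f(1)])
      fix j :: nat assume "3 \<le> j"
      then show "preserves (2 * (2 * j)) (indep_rel (2 * j) (clique_path j)) f \<longleftrightarrow> j \<noteq> k"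
        using f(2) f(3)[of "2 * j" "clique_path j"] clique_path_hom_onto_end by metis
    qed
  qed
qed

section \<open>Cardinality of the interval\<close>

theorem corollary10:
  "clone_interval (pPol_le \<inter> pPol_ne) Par \<approx> (UNIV :: real set)"
proof -
  have "clone_interval (pPol_le \<inter> pPol_ne) Par \<approx> (UNIV :: nat set set)"
  proof (rule lepoll_antisym)
    have "clone_interval (pPol_le \<inter> pPol_ne) Par \<subseteq> Pow Par"
      by (auto simp: clone_interval_def)
    moreover have "inj_on (image (to_nat_on Par)) (Pow Par)"
      using inj_on_to_nat_on[OF countable_Par] by (rule inj_on_image_Pow)
    ultimately show "clone_interval (pPol_le \<inter> pPol_ne) Par \<lesssim> (UNIV :: nat set set)"
      unfolding lepoll_def by (meson inj_on_subset subset_UNIV)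
  next
    \<comment> \<open>The shift by 3 lets \<open>X\<close> range over all sets of naturals while
      every clique contains a triangle.\<close>
    define C where "C X = {f \<in> Par. \<forall>k\<in>X.
      preserves (2 * (2 * (k + 3))) (indep_rel (2 * (k + 3)) (clique_path (k + 3))) f}"
      for X :: "nat set"
    have "C X \<in> clone_interval (pPol_le \<inter> pPol_ne) Par" for X
    proof -
      have "partial_clone (C X)"
        unfolding C_def by (rule partial_clone_preserves)
      moreover have "pPol_le \<inter> pPol_ne \<subseteq> C X"
      proof
        fix f assume f: "f \<in> pPol_le \<inter> pPol_ne"
        then have "f \<in> Par"
          by (simp add: pPol_def)
        with f show "f \<in> C X"
          unfolding C_def by (blast intro: preserves_indep_rel)
      qed
      ultimately show ?thesis
        by (auto simp: clone_interval_def C_def)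
    qed
    moreover have "inj C"
    proof (rule injI)
      fix X Y assume "C X = C Y"
      have "k \<in> X \<longleftrightarrow> k \<in> Y" for k
      proof -
        obtain f where f: "f \<in> Par"
          "\<And>j. 3 \<le> j \<Longrightarrow> preserves (2 * (2 * j)) (indep_rel (2 * j) (clique_path j)) f \<longleftrightarrow> j \<noteq> k + 3"
          using clique_path_separated[of "k + 3"] by auto
        \<comment> \<open>Among these relations \<open>f\<close> violates only the one with index
          \<open>k\<close>, so it detects whether \<open>k\<close> belongs to the set.\<close>
        have "f \<in> C Z \<longleftrightarrow> k \<notin> Z" for Z
          using f(1) f(2)[OF le_add2] by (auto simp: C_def)
        then show ?thesis
          using \<open>C X = C Y\<close> by blast
      qed
      then show "X = Y"
        by blast
    qed
    ultimately show "(UNIV :: nat set set) \<lesssim> clone_interval (pPol_le \<inter> pPol_ne) Par"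
      unfolding lepoll_def by blast
  qed
  then show ?thesis
    using nat_sets_eqpoll_reals by (rule eqpoll_trans)
qed

end
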